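(* Let $q\in\mathbb{C}$ with $0<|q|<1$. (1) If $w\in\mathbb{C}\setminus\{0\}$ and $w\neq q^{\ell}$ for all $\ell\in\mathbb{Z}$, then $$g_{3,2}(w;q^{-1})=\psi_1(w^{-1};q)+S_2(w^{-1};q).$$ (2) If $w\in\mathbb{C}\setminus\{0\}$ and $w\neq q^{\ell}$ for all $\ell\in\mathbb{N}_0$, then $$g_{3,3}(w;q^{-1})=\psi_1(w^{-1};q).$$
   Context: Notation: for any base $p\in\mathbb{C}\setminus\{0\}$, $(a;p)_n:=\prod_{j=0}^{n-1}(1-ap^j)$ for $n\in\mathbb{N}_0$, and $(a_1,\dots,a_r;p)_n:=(a_1;p)_n\cdots(a_r;p)_n$; for $|p|<1$ also $(a;p)_\infty:=\prod_{j\ge0}(1-ap^j)$ and similarly for several arguments. When the base is omitted it is $q$. $\mathbb{N}_0=\{0,1,2,\dots\}$, and $\left(\frac{\cdot}{\cdot}\right)$ is the Kronecker symbol. For a base $p$ with $|p|\neq1$, define by the following series (for $p=q^{-1}$ one uses the same series, with every occurrence of the base replaced by $q^{-1}$): $$R(w;p):=1+\sum_{n\ge1}\frac{p^{n^2}}{(wp;p)_n(w^{-1}p;p)_n},\qquad g_{3,2}(w;p):=-\frac1w+\frac{1}{w(1-w)}R(w;p),$$ $$g_{3,3}(w;p):=\sum_{n\ge0}\frac{w^{-n}p^n}{(w;p)_{n+1}}.$$ For $|q|<1$ define $$\psi_1(w;q):=-w-w^2\sum_{n\ge0}\left(\frac{12}{n}\right)w^{\frac{n-1}{2}}q^{\frac{n^2-1}{24}},\qquad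 \psi_2(w;q):=\sum_{n\ge0}w^nq^{\frac{n(n+1)}2}$$ (in $\psi_1$ the Kronecker symbol vanishes unless $\gcd(n,12)=1$, so only integral exponents occur), and, for $w\ne0$, $w\neq q^{\ell}$ $(\ell\in\mathbb{Z})$, $$S_2(w;q):=\frac{w^2}{(wq,w^{-1})_\infty}\,\psi_2(-w^2;q).$$ *)

theory Defs
  imports "HOL-Analysis.Analysis" "HOL-Number_Theory.Number_Theory"
begin

definition qpoch :: "complex \<Rightarrow> complex \<Rightarrow> nat \<Rightarrow> complex" where
  "qpoch a p n = (\<Prod>j<n. 1 - a * p ^ j)"

definition qpoch_inf :: "complex \<Rightarrow> complex \<Rightarrow> complex" where
  "qpoch_inf a p = (\<Prod>j. 1 - a * p ^ j)"

definition kronecker_prime :: "int \<Rightarrow> int \<Rightarrow> int" where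
  "kronecker_prime a p =
     (if p = 2 then
        (if even a then 0 else if a mod 8 = 1 \<or> a mod 8 = 7 then 1 else -1)
      else Legendre a p)"

text \<open>The Kronecker symbol for arbitrary integers. The set \<open>prime_factors n\<close> consists of the
  positive prime divisors; the factor \<open>-1\<close> is the value at the unit part of \<open>n\<close>.\<close>

definition kronecker :: "int \<Rightarrow> int \<Rightarrow> int" where
  "kronecker a n =
     (if n = 0 then (if \<bar>a\<bar> = 1 then 1 else 0)
      else (if n < 0 \<and> a < 0 then -1 else 1) *
           (\<Prod>p\<in>prime_factors n. kronecker_prime a p ^ multiplicity p n))"

text \<open>In the functions of \<open>w\<close> and \<open>p\<close> below, \<open>p\<close> is the base and may be
  inside or outside the unit disc.\<close>

definition R_fun :: "complex \<Rightarrow> complex \<Rightarrow> complex" where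
  "R_fun w p = 1 + (\<Sum>k. let n = Suc k in
     p ^ (n\<^sup>2) / (qpoch (w * p) p n * qpoch (inverse w * p) p n))"

definition g32 :: "complex \<Rightarrow> complex \<Rightarrow> complex" where
  "g32 w p = - (1 / w) + 1 / (w * (1 - w)) * R_fun w p"

definition g33 :: "complex \<Rightarrow> complex \<Rightarrow> complex" where
  "g33 w p = (\<Sum>n. inverse w ^ n * p ^ n / qpoch w p (n + 1))"

text \<open>The symbol vanishes unless \<open>n\<close> is coprime to \<open>12\<close>; for such \<open>n\<close> both divisions in the
  exponents are exact, and \<open>n \<ge> 1\<close>, so the subtractions are not truncated.\<close>

definition psi1 :: "complex \<Rightarrow> complex \<Rightarrow> complex" where
  "psi1 w q = - w - w\<^sup>2 *
     (\<Sum>n. of_int (kronecker 12 (int n)) * w ^ ((n - 1) div 2) * q ^ ((n\<^sup>2 - 1) div 24))"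

definition psi2 :: "complex \<Rightarrow> complex \<Rightarrow> complex" where
  "psi2 w q = (\<Sum>n. w ^ n * q ^ (n * (n + 1) div 2))"

definition S2 :: "complex \<Rightarrow> complex \<Rightarrow> complex" where
  "S2 w q = w\<^sup>2 / (qpoch_inf (w * q) q * qpoch_inf (inverse w) q) * psi2 (- (w\<^sup>2)) q"

end

theory Submission
  imports Defs
begin

text \<open>
  Put \<open>x = 1 / w\<close> and let \<open>A(x) = (\<Sum>m. (-1)^m x^(3m) q^(m(3m+1)/2) (1 - x^2 q^(2m+1)))\<close>, which is
  the series in \<open>\<psi>\<^sub>1\<close> grouped by residues modulo 6. Inverting the base turns \<open>g\<^sub>3\<^sub>,\<^sub>3\<close> into
  \<open>-x F(x)\<close> with \<open>F(x) = (\<Sum>n. (-1)^n x^(2n) q^(n(n-1)/2) / (x;q)\<^sub>n\<^sub>+\<^sub>1)\<close>, and \<open>R\<close> into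
  \<open>G(x) = (\<Sum>n. q^n / ((xq;q)\<^sub>n (q/x;q)\<^sub>n))\<close>. Telescoping shows that both
  \<open>E(x) = (F(x) - 1) / x\<close> and \<open>E(x) = (G(x) - T(x)) / (1 - x)\<close>, where
  \<open>T(x) = x \<psi>\<^sub>2(-x^2) / ((xq;q)\<^sub>\<infinity> (q/x;q)\<^sub>\<infinity>)\<close>, satisfy
  \<open>E(x) = 1 - x^2 q - x^3 q^2 E(xq)\<close>. Since \<open>E(x q^m)\<close> grows at most geometrically in \<open>m\<close>,
  iterating this equation gives \<open>E = A\<close> in both cases.
\<close>

section \<open>The Kronecker symbol of 12\<close>

text \<open>The even primitive quadratic character modulo 12, given by its values on
  residues.\<close>

definition chi12 :: "int \<Rightarrow> int" where
  "chi12 n = (if n mod 12 \<in> {1, 11} then 1 else if n mod 12 \<in> {5, 7} then -1 else 0)"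

text \<open>Both sides depend only on residues modulo 12, which leaves a finite check over pairs of
  residues.\<close>

lemma chi12_mult: "chi12 (a * b) = chi12 a * chi12 b"
proof -
  have "(a * b) mod 12 = ((a mod 12) * (b mod 12)) mod 12"
    by (simp add: mod_mult_eq)
  moreover have "a mod 12 \<in> {0,1,2,3,4,5,6,7,8,9,10,11}" "b mod 12 \<in> {0,1,2,3,4,5,6,7,8,9,10,11}"
    by (simp_all, presburger+)
  ultimately show ?thesis
    unfolding chi12_def by (elim insertE emptyE) simp_all
qed

lemma prime_int_mod_12:
  fixes p :: int
  assumes "prime p" "p > 3"
  shows "p mod 12 \<in> {1, 5, 7, 11}"
proof -
  have "\<not> 2 dvd p" "\<not> 3 dvd p"
    using assms primes_dvd_imp_eq[of 2 p] primes_dvd_imp_eq[of 3 p] by auto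
  then show ?thesis by simp presburger
qed

lemma Legendre_mod_3:
  fixes p :: int
  assumes "\<not> 3 dvd p"
  shows "Legendre p 3 = (if p mod 3 = 1 then 1 else -1)"
proof -
  have "QuadRes 3 p \<longleftrightarrow> p mod 3 = 1"
  proof
    assume "QuadRes 3 p"
    then obtain y where y: "y\<^sup>2 mod 3 = p mod 3"
      by (auto simp: QuadRes_def cong_def)
    have "y\<^sup>2 mod 3 = (y mod 3)\<^sup>2 mod 3" by (simp add: power_mod)
    moreover have "y mod 3 \<in> {0, 1, 2}" by simp presburger
    ultimately have "y\<^sup>2 mod 3 \<in> {0, 1}" by auto
    with y assms show "p mod 3 = 1" by (auto simp: dvd_eq_mod_eq_0)
  next
    assume "p mod 3 = 1"
    then have "[1\<^sup>2 = p] (mod 3)" by (simp add: cong_def)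
    then show "QuadRes 3 p" unfolding QuadRes_def by blast
  qed
  with assms show ?thesis by (simp add: Legendre_def cong_def dvd_eq_mod_eq_0)
qed

text \<open>Since 12 = 2^2 * 3 and 2 is invertible modulo an odd prime, 12 and 3 are squares modulo
  \<open>p\<close> simultaneously.\<close>

lemma Legendre_12:
  fixes p :: int
  assumes "prime p" "p > 3"
  shows "Legendre 12 p = Legendre 3 p"
proof -
  have odd: "odd p" using assms prime_odd_int by simp
  have cop: "coprime 4 p"
    using odd by (metis coprime_left_2_iff_odd coprime_mult_left_iff mult_2 numeral_Bit0)
  have "QuadRes p 12 \<longleftrightarrow> QuadRes p 3"
  proof
    assume "QuadRes p 12"
    then obtain y where y: "[y\<^sup>2 = 12] (mod p)" by (auto simp: QuadRes_def)
    obtain h where h: "p = 2 * h + 1" using odd by (rule oddE)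
    \<comment> \<open>Modulo \<open>p = 2 * h + 1\<close> the inverse of 2 is \<open>h + 1\<close>,
      so \<open>y * (h + 1)\<close> stands for y / 2.\<close>
    have "[4 * (y * (h + 1))\<^sup>2 = y\<^sup>2] (mod p)"
    proof -
      have "4 * (y * (h + 1))\<^sup>2 - y\<^sup>2 = p * (y\<^sup>2 * (p + 2))"
        unfolding h by (simp add: power2_eq_square algebra_simps)
      then show ?thesis by (simp add: cong_iff_dvd_diff)
    qed
    with y have "[4 * (y * (h + 1))\<^sup>2 = 4 * 3] (mod p)" by (simp add: cong_trans)
    with cop have "[(y * (h + 1))\<^sup>2 = 3] (mod p)" using cong_mult_lcancel by blast
    then show "QuadRes p 3" unfolding QuadRes_def by blast
  next
    assume "QuadRes p 3"
    then obtain y where "[y\<^sup>2 = 3] (mod p)" by (auto simp: QuadRes_def)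
    then have "[4 * y\<^sup>2 = 4 * 3] (mod p)" by (intro cong_mult cong_refl)
    then have "[(2 * y)\<^sup>2 = 12] (mod p)" by (simp add: power_mult_distrib)
    then show "QuadRes p 12" unfolding QuadRes_def by blast
  qed
  moreover have "[12 = 0] (mod p) \<longleftrightarrow> [3 = 0] (mod p)"
    using cong_mult_lcancel[OF cop, of 3 0] by simp
  ultimately show ?thesis by (simp add: Legendre_def)
qed

text \<open>Quadratic reciprocity reduces the symbol to \<open>p\<close> modulo 3 and a sign
  depending on \<open>p\<close> modulo 4; both can be read off from \<open>p\<close> modulo
  12.\<close>

lemma Legendre_3:
  fixes p :: int
  assumes "prime p" "p > 3"
  shows "Legendre 3 p = chi12 p"
proof -
  have nd: "\<not> 3 dvd p" using assms primes_dvd_imp_eq[of 3 p] by auto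
  have "prime (nat p)" using assms(1) prime_int_nat_transfer by blast
  then have "Legendre p 3 * Legendre 3 p = (-1) ^ nat ((p - 1) div 2 * ((3 - 1) div 2))"
    using assms by (intro Quadratic_Reciprocity_int) auto
  then have rec: "Legendre p 3 * Legendre 3 p = (-1) ^ nat ((p - 1) div 2)" by simp
  have L3: "Legendre p 3 = (if p mod 3 = 1 then 1 else -1)"
    using nd by (rule Legendre_mod_3)
  \<comment> \<open>Because \<open>div\<close> rounds down, residue 2 modulo 4 gives the same parity
    as residue 1.\<close>
  have ev: "even (nat ((p - 1) div 2)) \<longleftrightarrow> p mod 4 \<in> {1, 2}"
    using assms by (simp add: even_nat_iff) presburger
  have sgn: "(-1 :: int) ^ nat ((p - 1) div 2) = (if p mod 4 \<in> {1, 2} then 1 else -1)"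
    using ev by (simp add: minus_one_power_iff)
  have mods: "p mod 12 mod 3 = p mod 3" "p mod 12 mod 4 = p mod 4"
    by (simp_all add: mod_mod_cancel)
  from prime_int_mod_12[OF assms] consider
      "p mod 12 = 1" | "p mod 12 = 5" | "p mod 12 = 7" | "p mod 12 = 11"
    by auto
  then show ?thesis
  proof cases
    case 1
    with mods have "p mod 3 = 1" "p mod 4 = 1" by simp_all
    with 1 rec L3 sgn show ?thesis by (simp add: chi12_def)
  next
    case 2
    with mods have "p mod 3 = 2" "p mod 4 = 1" by simp_all
    with 2 rec L3 sgn show ?thesis by (simp add: chi12_def)
  next
    case 3
    with mods have "p mod 3 = 1" "p mod 4 = 3" by simp_all
    with 3 rec L3 sgn show ?thesis by (simp add: chi12_def)
  next
    case 4
    with mods have "p mod 3 = 2" "p mod 4 = 3" by simp_all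
    with 4 rec L3 sgn show ?thesis by (simp add: chi12_def)
  qed
qed

lemma kronecker_prime_12:
  fixes p :: int
  assumes "prime p"
  shows "kronecker_prime 12 p = chi12 p"
proof -
  consider "p = 2" | "p = 3" | "p > 3" using prime_ge_2_int[OF assms] by linarith
  then show ?thesis
  proof cases
    case 1 then show ?thesis by (simp add: kronecker_prime_def chi12_def)
  next
    case 2 then show ?thesis by (simp add: kronecker_prime_def chi12_def Legendre_def cong_def)
  next
    case 3 then show ?thesis
      using assms Legendre_12 Legendre_3 by (simp add: kronecker_prime_def)
  qed
qed

text \<open>Both sides are completely multiplicative on positive integers and agree at primes, so
  the prime factorization carries the equality over; at 0 both vanish.\<close>

lemma kronecker_12:
  fixes n :: int
  assumes "n \<ge> 0"
  shows "kronecker 12 n = chi12 n"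
proof (cases "n = 0")
  case True then show ?thesis by (simp add: kronecker_def chi12_def)
next
  case False
  have "chi12 (prod_mset A) = prod_mset (image_mset chi12 A)" for A
    by (induction A) (simp_all add: chi12_mult, simp add: chi12_def)
  moreover have "prod_mset (prime_factorization n) = n"
    using assms False by (simp add: prod_mset_prime_factorization)
  ultimately have "chi12 n = prod_mset (image_mset chi12 (prime_factorization n))"
    by metis
  also have "\<dots> = (\<Prod>p\<in>prime_factors n. chi12 p ^ count (prime_factorization n) p)"
    by (rule image_prod_mset_multiplicity)
  also have "\<dots> = (\<Prod>p\<in>prime_factors n. kronecker_prime 12 p ^ multiplicity p n)"
    by (intro prod.cong refl)
      (simp add: kronecker_prime_12 in_prime_factors_iff count_prime_factorization_prime)
  finally show ?thesis using assms False by (simp add: kronecker_def)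
qed

section \<open>Finite and infinite q-Pochhammer symbols\<close>

lemma Suc_choose_two: "Suc n choose 2 = (n choose 2) + n"
  by (simp add: numeral_2_eq_2)

text \<open>The ratio of consecutive terms is \<open>a * r ^ n\<close>, which tends to 0 for every
  \<open>a\<close>. This is the majorant for all theta-like series below.\<close>

lemma summable_power_choose_two:
  fixes a r :: real
  assumes "0 \<le> r" "r < 1"
  shows "summable (\<lambda>n. a ^ n * r ^ (n choose 2))"
proof -
  have "(\<lambda>n. a * r ^ n) \<longlonglongrightarrow> a * 0"
    by (intro tendsto_mult tendsto_const LIMSEQ_realpow_zero assms)
  from metric_LIMSEQ_D[OF this, of "1 / 2"] obtain N where N: "\<And>n. n \<ge> N \<Longrightarrow> norm (a * r ^ n) < 1 / 2"
    by (auto simp: dist_norm)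
  show ?thesis
  proof (rule summable_ratio_test)
    fix n assume "N \<le> n"
    have "norm (a ^ Suc n * r ^ (Suc n choose 2)) = norm (a * r ^ n) * norm (a ^ n * r ^ (n choose 2))"
      by (simp add: Suc_choose_two power_add abs_mult mult_ac)
    also have "\<dots> \<le> 1 / 2 * norm (a ^ n * r ^ (n choose 2))"
      using N[OF \<open>N \<le> n\<close>] by (intro mult_right_mono) auto
    finally show "norm (a ^ Suc n * r ^ (Suc n choose 2)) \<le> 1 / 2 * norm (a ^ n * r ^ (n choose 2))" .
  qed simp
qed

lemma qpoch_0 [simp]: "qpoch a q 0 = 1"
  by (simp add: qpoch_def)

lemma qpoch_Suc: "qpoch a q (Suc n) = qpoch a q n * (1 - a * q ^ n)"
  by (simp add: qpoch_def)

lemma qpoch_add: "qpoch a q (m + n) = qpoch a q m * qpoch (a * q ^ m) q n"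
  by (induction n) (simp_all add: qpoch_Suc power_add mult_ac)

lemma qpoch_Suc_shift: "qpoch a q (Suc n) = (1 - a) * qpoch (a * q) q n"
  using qpoch_add[of a q 1 n] by (simp add: qpoch_Suc)

lemma qpoch_nonzero: "(\<And>j. a * q ^ j \<noteq> 1) \<Longrightarrow> qpoch a q n \<noteq> 0"
  by (simp add: qpoch_def)

text \<open>Each factor satisfies 1 - a q^(-j) = -a q^(-j) (1 - q^j / a), and the exponents j < n
  add up to \<open>n choose 2\<close>.\<close>

lemma qpoch_inverse_base:
  assumes "a \<noteq> 0" "q \<noteq> 0"
  shows "qpoch a (inverse q) n = (- a) ^ n * inverse q ^ (n choose 2) * qpoch (inverse a) q n"
proof (induction n)
  case (Suc n)
  have "1 - a * inverse q ^ n = - a * inverse q ^ n * (1 - inverse a * q ^ n)"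
    using assms by (simp add: power_inverse right_diff_distrib mult.assoc mult.left_commute[of _ "inverse a"])
  with Suc show ?case by (simp add: qpoch_Suc Suc_choose_two power_add)
qed (simp add: numeral_2_eq_2)

lemma
  fixes a q :: complex
  assumes "norm q < 1" and ne: "\<And>j. a * q ^ j \<noteq> 1"
  shows qpoch_tendsto: "qpoch a q \<longlonglongrightarrow> qpoch_inf a q"
    and qpoch_inf_nonzero: "qpoch_inf a q \<noteq> 0"
proof -
  have "summable (\<lambda>j. norm (- (a * q ^ j)))"
    using assms(1) by (simp add: norm_mult norm_power summable_mult summable_geometric)
  then have "convergent_prod (\<lambda>j. 1 + - (a * q ^ j))"
    using ne by (intro summable_imp_convergent_prod_complex) auto
  then have cp: "convergent_prod (\<lambda>j. 1 - a * q ^ j)" by simp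
  have "(\<lambda>n. qpoch a q (Suc n)) \<longlonglongrightarrow> qpoch_inf a q"
    using convergent_prod_LIMSEQ[OF cp]
    by (simp add: qpoch_def qpoch_inf_def lessThan_Suc_atMost)
  then show "qpoch a q \<longlonglongrightarrow> qpoch_inf a q" by (rule LIMSEQ_imp_Suc)
  show "qpoch_inf a q \<noteq> 0"
    unfolding qpoch_inf_def using ne by (intro prodinf_nonzero cp) simp
qed

lemma qpoch_inf_shift:
  fixes a q :: complex
  assumes "norm q < 1" and ne: "\<And>j. a * q ^ j \<noteq> 1"
  shows "qpoch_inf a q = (1 - a) * qpoch_inf (a * q) q"
proof (rule LIMSEQ_unique)
  have "a * q * q ^ j \<noteq> 1" for j using ne[of "Suc j"] by (simp add: mult.assoc)
  then have "(\<lambda>n. (1 - a) * qpoch (a * q) q n) \<longlonglongrightarrow> (1 - a) * qpoch_inf (a * q) q"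
    by (intro tendsto_mult tendsto_const qpoch_tendsto assms(1))
  then show "(\<lambda>n. qpoch a q (Suc n)) \<longlonglongrightarrow> (1 - a) * qpoch_inf (a * q) q"
    by (simp add: qpoch_Suc_shift)
  show "(\<lambda>n. qpoch a q (Suc n)) \<longlonglongrightarrow> qpoch_inf a q"
    using qpoch_tendsto[OF assms] by (rule LIMSEQ_Suc)
qed

text \<open>The reciprocal is (a;q)_m / (a;q)_(m+n). Numerators and reciprocal denominators are
  bounded because (a;q)_n converges to a nonzero limit, so one bound serves all \<open>m\<close> and
  \<open>n\<close>.\<close>

lemma inverse_qpoch_shift_bounded:
  fixes a q :: complex
  assumes "norm q < 1" and ne: "\<And>j. a * q ^ j \<noteq> 1"
  shows "\<exists>B>0. \<forall>m n. norm (inverse (qpoch (a * q ^ m) q n)) \<le> B"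
proof -
  have lim: "qpoch a q \<longlonglongrightarrow> qpoch_inf a q" and nz: "qpoch_inf a q \<noteq> 0"
    using qpoch_tendsto[OF assms] qpoch_inf_nonzero[OF assms] .
  have "Bseq (qpoch a q)" "Bseq (\<lambda>n. inverse (qpoch a q n))"
    using lim tendsto_inverse[OF lim nz] by (auto intro!: convergent_imp_Bseq convergentI)
  then obtain K L where KL: "K > 0" "L > 0" "\<And>n. norm (qpoch a q n) \<le> K"
      "\<And>n. norm (inverse (qpoch a q n)) \<le> L"
    by (elim BseqE) blast
  have "norm (inverse (qpoch (a * q ^ m) q n)) \<le> K * L" for m n
  proof -
    have "inverse (qpoch (a * q ^ m) q n) = qpoch a q m * inverse (qpoch a q (m + n))"
      using qpoch_nonzero[of a q m, OF ne] by (simp add: qpoch_add)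
    then have "norm (inverse (qpoch (a * q ^ m) q n)) =
        norm (qpoch a q m) * norm (inverse (qpoch a q (m + n)))"
      by (simp only: norm_mult)
    also have "\<dots> \<le> K * L"
      by (intro mult_mono KL norm_ge_zero less_imp_le[OF KL(1)])
    finally show ?thesis .
  qed
  moreover have "K * L > 0" using KL by simp
  ultimately show ?thesis by (intro exI[of _ "K * L"] conjI allI)
qed

text \<open>Dividing the argument by \<open>q\<close> once more prepends one factor 1 - y / q^k. Its
  reciprocal is bounded uniformly in k, so each such step costs at most a constant
  \<open>K\<close>.\<close>

lemma inverse_qpoch_unshift_bound:
  fixes y q :: complex
  assumes "norm q < 1" "q \<noteq> 0" "y \<noteq> 0"
    and ne: "\<And>j. y * q ^ j \<noteq> 1" "\<And>j. y \<noteq> q ^ j"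
  obtains B K where "B > 0" "K > 0" "\<And>m n. norm (inverse (qpoch (y / q ^ m) q n)) \<le> B * K ^ m"
proof -
  obtain B where B: "B > 0" "\<And>m n. norm (inverse (qpoch (y * q ^ m) q n)) \<le> B"
    using inverse_qpoch_shift_bounded[OF assms(1) ne(1)] by blast
  have "inverse y * q ^ j \<noteq> 1" for j
    using ne(2)[of j] assms(3) by (simp add: inverse_eq_divide)
  then obtain D where D: "D > 0" "\<And>m n. norm (inverse (qpoch (inverse y * q ^ m) q n)) \<le> D"
    using inverse_qpoch_shift_bounded[OF assms(1), of "inverse y"] by blast
  \<comment> \<open>The summand 1 ensures \<open>K\<close> is at least 1, which covers the empty
    product \<open>n = 0\<close> in the induction.\<close>
  define K where "K = 1 + D / norm y"
  have K: "K \<ge> 1" using D assms by (simp add: K_def)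
  have fac: "norm (inverse (1 - y / q ^ k)) \<le> K" for k
  proof -
    have "1 - y / q ^ k = - (y / q ^ k) * (1 - inverse y * q ^ k)"
      using assms(2,3) by (simp add: field_simps)
    \<comment> \<open>The single factor is written as a symbol of length 1 so that \<open>D\<close>
      bounds its reciprocal.\<close>
    then have "inverse (1 - y / q ^ k) = - (q ^ k) / y * inverse (qpoch (inverse y * q ^ k) q 1)"
      by (simp add: qpoch_Suc inverse_eq_divide)
    then have "norm (inverse (1 - y / q ^ k)) =
        norm q ^ k * norm (inverse (qpoch (inverse y * q ^ k) q 1)) / norm y"
      by (simp add: norm_mult norm_divide norm_power)
    also have "\<dots> \<le> 1 * D / norm y"
      using D assms by (intro divide_right_mono mult_mono power_le_one) auto
    finally show ?thesis by (simp add: K_def)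
  qed
  have "norm (inverse (qpoch (y / q ^ m) q n)) \<le> B * K ^ m" for m n
  proof (induction m arbitrary: n)
    case 0
    then show ?case using B(2)[of 0 n] by simp
  next
    case (Suc m)
    show ?case
    proof (cases n)
      case 0
      have "1 \<le> B" using B(2)[of 0 0] by simp
      moreover have "1 \<le> K ^ Suc m" using K by (rule one_le_power)
      ultimately show ?thesis using 0 mult_mono[of 1 B 1 "K ^ Suc m"] by simp
    next
      case (Suc n')
      have "qpoch (y / q ^ Suc m) q n = (1 - y / q ^ Suc m) * qpoch (y / q ^ m) q n'"
        using assms by (simp add: Suc qpoch_Suc_shift)
      then have "norm (inverse (qpoch (y / q ^ Suc m) q n)) =
          norm (inverse (1 - y / q ^ Suc m)) * norm (inverse (qpoch (y / q ^ m) q n'))"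
        by (simp add: norm_mult norm_inverse)
      also have "\<dots> \<le> K * (B * K ^ m)"
        using K by (intro mult_mono fac Suc.IH) auto
      finally show ?thesis by (simp add: mult_ac)
    qed
  qed
  with B(1) K show ?thesis by (intro that[of B K]) auto
qed

section \<open>The partial theta series\<close>

text \<open>After \<open>m\<close> steps the remainder carries \<open>q\<close> to a power quadratic in \<open>m\<close>, which beats any
  geometric growth of \<open>E\<close>.\<close>

lemma partial_theta_sums:
  fixes x q :: complex and E :: "nat \<Rightarrow> complex"
  assumes "norm q < 1" "K \<ge> 0"
    and rec: "\<And>m. E m = 1 - (x * q ^ m)\<^sup>2 * q - (x * q ^ m) ^ 3 * q\<^sup>2 * E (Suc m)"
    and bound: "\<And>m. norm (E m) \<le> C * K ^ m"
  shows "(\<lambda>m. (-1) ^ m * x ^ (3 * m) * q ^ (2 * m + 3 * (m choose 2)) *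
            (1 - x\<^sup>2 * q ^ (2 * m + 1))) sums E 0"
proof -
  \<comment> \<open>\<open>c m\<close> is the product of the multipliers -(x q^j)^3 q^2, j < m,
    collected by iterating \<open>rec\<close>.\<close>
  define c where "c m = (-1) ^ m * x ^ (3 * m) * q ^ (2 * m + 3 * (m choose 2))" for m
  have cube: "(x * q ^ m) ^ 3 = x ^ 3 * q ^ (3 * m)" for m
    by (simp add: power_mult_distrib mult.commute flip: power_mult)
  have "2 * Suc m + 3 * (Suc m choose 2) = (2 * m + 3 * (m choose 2)) + 3 * m + 2" for m
    by (simp add: Suc_choose_two)
  then have c_Suc: "c (Suc m) = - (c m * (x ^ 3 * q ^ (3 * m)) * q\<^sup>2)" for m
    by (simp only: c_def power_add) (simp add: power_add power3_eq_cube)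
  \<comment> \<open>Iterating \<open>rec\<close> exactly n times leaves the remainder
    \<open>c n * E n\<close>.\<close>
  have "(\<Sum>m<n. c m * (1 - x\<^sup>2 * q ^ (2 * m + 1))) = E 0 - c n * E n" for n
  proof (induction n)
    case 0 then show ?case by (simp add: c_def binomial_eq_0)
  next
    case (Suc n)
    have "(x * q ^ n)\<^sup>2 * q = x\<^sup>2 * q ^ (2 * n + 1)"
      by (simp add: power_mult_distrib mult.commute flip: power_mult)
    then have "E n = 1 - x\<^sup>2 * q ^ (2 * n + 1) - x ^ 3 * q ^ (3 * n) * q\<^sup>2 * E (Suc n)"
      using rec[of n] by (simp only: cube)
    then have "c n * E n = c n * (1 - x\<^sup>2 * q ^ (2 * n + 1)) + c (Suc n) * E (Suc n)"
      by (simp only: c_Suc) (simp add: algebra_simps)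
    with Suc show ?case by simp
  qed
  moreover have "(\<lambda>n. c n * E n) \<longlonglongrightarrow> 0"
  proof (rule Lim_null_comparison)
    have "(\<lambda>n. C * ((norm x ^ 3 * norm q ^ 2 * K) ^ n * norm q ^ (n choose 2))) \<longlonglongrightarrow> C * 0"
      using assms(1,2) by (intro tendsto_mult tendsto_const summable_LIMSEQ_zero
          summable_power_choose_two) auto
    then show "(\<lambda>n. C * ((norm x ^ 3 * norm q ^ 2 * K) ^ n * norm q ^ (n choose 2))) \<longlonglongrightarrow> 0"
      by simp
    have C: "C \<ge> 0" using bound[of 0] norm_ge_zero[of "E 0"] by (simp del: norm_ge_zero)
    show "\<forall>\<^sub>F n in sequentially. norm (c n * E n)
        \<le> C * ((norm x ^ 3 * norm q ^ 2 * K) ^ n * norm q ^ (n choose 2))"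
    proof (intro always_eventually allI)
      fix n
      have "norm (c n * E n) = norm x ^ (3 * n) * norm q ^ (2 * n) * norm q ^ (3 * (n choose 2)) * norm (E n)"
        by (simp add: c_def norm_mult norm_power power_add)
      \<comment> \<open>One of the three copies of \<open>n choose 2\<close> in the exponent already
        suffices to absorb \<open>K ^ n\<close>.\<close>
      also have "\<dots> \<le> norm x ^ (3 * n) * norm q ^ (2 * n) * norm q ^ (n choose 2) * (C * K ^ n)"
        using assms(1) by (intro mult_mono bound mult_left_mono power_decreasing) auto
      also have "\<dots> = C * ((norm x ^ 3 * norm q ^ 2 * K) ^ n * norm q ^ (n choose 2))"
        by (simp add: power_mult_distrib mult_ac flip: power_mult)
      finally show "norm (c n * E n) \<le> \<dots>" .
    qed
  qed
  ultimately have "(\<lambda>n. \<Sum>m<n. c m * (1 - x\<^sup>2 * q ^ (2 * m + 1))) \<longlonglongrightarrow> E 0 - 0"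
    by (simp only:) (intro tendsto_diff tendsto_const)
  then show ?thesis by (simp add: sums_def c_def)
qed

text \<open>Only n congruent to 1 or 5 modulo 6 contribute: n = 6m+1 gives \<open>a m\<close> and n
  = 6m+5 gives \<open>b m\<close>, and each pair forms one term of the grouped series.\<close>

lemma psi1_eq_partial_theta:
  assumes "norm q < 1"
    and sums: "(\<lambda>m. (-1) ^ m * x ^ (3 * m) * q ^ (2 * m + 3 * (m choose 2)) *
            (1 - x\<^sup>2 * q ^ (2 * m + 1))) sums S"
  shows "psi1 x q = - x - x\<^sup>2 * S"
proof -
  define f where
    "f n = of_int (kronecker 12 (int n)) * x ^ ((n - 1) div 2) * q ^ ((n\<^sup>2 - 1) div 24)" for n
  define a b where "a m = (-1) ^ m * x ^ (3 * m) * q ^ (2 * m + 3 * (m choose 2))"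
    and "b m = - (x\<^sup>2 * q ^ (2 * m + 1) * a m)" for m
  define f1 f5 where "f1 n = (if n mod 6 = 1 then f n else 0)"
    and "f5 n = (if n mod 6 = 5 then f n else 0)" for n
  \<comment> \<open>This identity makes the divisions by 24 exact: m(3m+1)/2 becomes
    \<open>2 * m + 3 * (m choose 2)\<close>.\<close>
  have even_choose: "2 * (m choose 2) + m = m * m" for m :: nat
    by (induction m) (simp_all add: Suc_choose_two)
  have chi: "kronecker 12 (int (6 * m + 1)) = (-1) ^ m" "kronecker 12 (int (6 * m + 5)) = - ((-1) ^ m)" for m
  proof -
    obtain k where "m = 2 * k \<or> m = 2 * k + 1" by (metis evenE oddE)
    moreover have "(12 * int k + c) mod 12 = c mod 12" for c by simp
    ultimately show "kronecker 12 (int (6 * m + 1)) = (-1) ^ m"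
        "kronecker 12 (int (6 * m + 5)) = - ((-1) ^ m)"
      by (auto simp: kronecker_12 chi12_def algebra_simps)
  qed
  have f_a: "f (6 * m + 1) = a m" for m
  proof -
    have "(6 * m + 1)\<^sup>2 - 1 = 24 * (2 * m + 3 * (m choose 2))"
      using even_choose[of m] by (simp add: power2_eq_square algebra_simps)
    then have "((6 * m + 1)\<^sup>2 - 1) div 24 = 2 * m + 3 * (m choose 2)" by simp
    moreover have "(6 * m + 1 - 1) div 2 = 3 * m" by simp
    ultimately show ?thesis by (simp only: f_def chi a_def of_int_power of_int_minus of_int_1)
  qed
  have f_b: "f (6 * m + 5) = b m" for m
  proof -
    have "(6 * m + 5)\<^sup>2 - 1 = 24 * (2 * m + 1 + (2 * m + 3 * (m choose 2)))"
      using even_choose[of m] by (simp add: power2_eq_square algebra_simps)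
    then have "((6 * m + 5)\<^sup>2 - 1) div 24 = 2 * m + 1 + (2 * m + 3 * (m choose 2))" by simp
    moreover have "(6 * m + 5 - 1) div 2 = 2 + 3 * m" by simp
    ultimately show ?thesis
      by (simp only: f_def chi a_def b_def of_int_power of_int_minus of_int_1 power_add) simp
  qed
  have a: "summable a"
  proof (rule summable_comparison_test')
    show "summable (\<lambda>n. (norm x ^ 3 * norm q ^ 2) ^ n * norm q ^ (n choose 2))"
      using assms(1) by (intro summable_power_choose_two) auto
    show "norm (a n) \<le> (norm x ^ 3 * norm q ^ 2) ^ n * norm q ^ (n choose 2)" for n
    proof -
      have "norm (a n) = norm x ^ (3 * n) * norm q ^ (2 * n) * norm q ^ (3 * (n choose 2))"
        by (simp add: a_def norm_mult norm_power power_add)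
      also have "\<dots> \<le> norm x ^ (3 * n) * norm q ^ (2 * n) * norm q ^ (n choose 2)"
        using assms(1) by (intro mult_left_mono power_decreasing) auto
      finally show ?thesis by (simp add: power_mult_distrib power_mult)
    qed
  qed
  have ab: "(\<lambda>m. a m + b m) sums S"
    using sums by (simp add: a_def b_def algebra_simps)
  \<comment> \<open>The hypothesis gives convergence of the paired series only; subtracting
    \<open>a\<close> from it yields \<open>b\<close>, so the pairs may be separated.\<close>
  have b: "summable b"
    using summable_diff[OF sums_summable[OF ab] a] by simp
  have range: "n \<in> range (\<lambda>m. 6 * m + r)" if "n mod 6 = r" for n r :: nat
    using that mult_div_mod_eq[of 6 n] by (intro range_eqI[of _ _ "n div 6"]) simp
  \<comment> \<open>\<open>f1\<close> and \<open>f5\<close> vanish off their residue classes, so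
    summing along 6m+1 or 6m+5 loses nothing.\<close>
  have "f1 sums suminf a \<longleftrightarrow> (\<lambda>m. f1 (6 * m + 1)) sums suminf a"
    using range[of _ 1] by (intro sums_mono_reindex[symmetric]) (auto simp: strict_mono_def f1_def)
  moreover have "f1 (6 * m + 1) = a m" for m
    unfolding f_a[symmetric] by (simp add: f1_def)
  ultimately have "f1 sums suminf a" using a by (simp add: summable_sums)
  moreover have "f5 sums suminf b \<longleftrightarrow> (\<lambda>m. f5 (6 * m + 5)) sums suminf b"
    using range[of _ 5] by (intro sums_mono_reindex[symmetric]) (auto simp: strict_mono_def f5_def)
  moreover have "f5 (6 * m + 5) = b m" for m
    unfolding f_b[symmetric] by (simp add: f5_def)
  moreover have "b sums suminf b" using b by (rule summable_sums)
  ultimately have "(\<lambda>n. f1 n + f5 n) sums (suminf a + suminf b)"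
    by (intro sums_add) simp_all
  moreover have "f n = f1 n + f5 n" for n
  proof -
    have "int n mod 12 mod 6 = int (n mod 6)" by (simp add: mod_mod_cancel zmod_int)
    then have "n mod 6 \<noteq> 1 \<Longrightarrow> n mod 6 \<noteq> 5 \<Longrightarrow> chi12 (int n) = 0"
      by (auto simp: chi12_def)
    then show ?thesis by (auto simp: f1_def f5_def f_def kronecker_12)
  qed
  then have "f = (\<lambda>n. f1 n + f5 n)" by (rule ext)
  ultimately have "suminf f = suminf a + suminf b" using sums_unique by metis
  also have "\<dots> = S" using sums_unique[OF ab] suminf_add[OF a b] by simp
  finally show ?thesis by (simp only: psi1_def f_def[abs_def])
qed

section \<open>The function g33 in the inverse base\<close>

text \<open>Summand of F(x). Up to the factor 1/(1-x), F is the limit, as a tends to infinity, of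
  Fine's series with terms (aq;q)_n t^n / (bq;q)_n, where b = x and t = x^2/(aq).\<close>

definition fine_term :: "complex \<Rightarrow> complex \<Rightarrow> nat \<Rightarrow> complex" where
  "fine_term x q n = (-1) ^ n * x ^ (2 * n) * q ^ (n choose 2) / qpoch x q (Suc n)"

text \<open>The bound is independent of \<open>m\<close>, since |x q^m| is at most |x| and the
  reciprocal symbols are uniformly bounded. It yields summability and also a bound for F along the
  whole orbit x q^m.\<close>

lemma norm_fine_term_le:
  assumes "norm q < 1" and ne: "\<And>j. x * q ^ j \<noteq> 1"
  obtains B where "B > 0"
    "\<And>m n. norm (fine_term (x * q ^ m) q n) \<le> B * ((norm x ^ 2) ^ n * norm q ^ (n choose 2))"
proof -
  obtain B where B: "B > 0" "\<And>m n. norm (inverse (qpoch (x * q ^ m) q n)) \<le> B"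
    using inverse_qpoch_shift_bounded[OF assms] by blast
  have "norm (fine_term (x * q ^ m) q n) \<le> B * ((norm x ^ 2) ^ n * norm q ^ (n choose 2))" for m n
  proof -
    have "norm (x * q ^ m) \<le> norm x * 1"
      unfolding norm_mult norm_power using assms(1) by (intro mult_left_mono power_le_one) auto
    then have le: "norm (x * q ^ m) ^ (2 * n) \<le> norm x ^ (2 * n)"
      by (intro power_mono) auto
    have "norm (fine_term (x * q ^ m) q n) =
        norm (inverse (qpoch (x * q ^ m) q (Suc n))) * (norm (x * q ^ m) ^ (2 * n) * norm q ^ (n choose 2))"
      by (simp add: fine_term_def norm_mult norm_divide norm_power norm_inverse divide_inverse mult_ac)
    also have "\<dots> \<le> B * (norm x ^ (2 * n) * norm q ^ (n choose 2))"
      using le B by (intro mult_mono mult_right_mono) auto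
    finally show ?thesis by (simp add: power_mult)
  qed
  with B(1) show ?thesis by (rule that)
qed

lemma summable_fine_term:
  assumes "norm q < 1" and ne: "\<And>j. x * q ^ j \<noteq> 1"
  shows "summable (fine_term x q)"
proof -
  obtain B where B: "B > 0"
    "\<And>m n. norm (fine_term (x * q ^ m) q n) \<le> B * ((norm x ^ 2) ^ n * norm q ^ (n choose 2))"
    using norm_fine_term_le[OF assms] by blast
  show ?thesis
  proof (rule summable_comparison_test')
    show "summable (\<lambda>n. B * ((norm x ^ 2) ^ n * norm q ^ (n choose 2)))"
      using assms(1) by (intro summable_mult summable_power_choose_two) auto
    show "norm (fine_term x q n) \<le> B * ((norm x ^ 2) ^ n * norm q ^ (n choose 2))" for n
      using B(2)[of 0 n] by simp
  qed
qed

lemma suminf_fine_term_shift: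
  assumes "norm q < 1" and ne: "\<And>j. x * q ^ j \<noteq> 1"
  shows "suminf (fine_term x q) = 1 + x - x ^ 3 * q * suminf (fine_term (x * q) q)"
proof -
  define t where "t = fine_term x q"
  define s where "s = fine_term (x * q) q"
  \<comment> \<open>The factor removes the last denominator factor of \<open>t n\<close>; hence
    \<open>u (Suc n)\<close> is again a multiple of \<open>t n\<close>, which makes the telescoping
    possible.\<close>
  define u where "u n = t n * (1 - x * q ^ n)" for n
  have ne': "x * q * q ^ j \<noteq> 1" for j using ne[of "Suc j"] by (simp add: mult.assoc)
  have t: "summable t" and s: "summable s"
    unfolding t_def s_def using assms ne' by (auto intro!: summable_fine_term)
  have x1: "1 - x \<noteq> 0" using ne[of 0] by simp
  have q0: "qpoch (x * q) q n \<noteq> 0" for n using ne' by (rule qpoch_nonzero)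
  have t_Suc: "t (Suc n) * (1 - x) = - (x\<^sup>2 * q ^ n * x ^ (2 * n) * (-1) ^ n * q ^ (n choose 2)) / qpoch (x * q) q (Suc n)" for n
    using x1 by (simp add: t_def fine_term_def qpoch_Suc_shift[of x q "Suc n"] Suc_choose_two power_add power2_eq_square)
  have s_t: "x ^ 3 * q * s n = - (x * q ^ Suc n * (t (Suc n) * (1 - x)))" for n
    unfolding t_Suc
    by (simp add: s_def fine_term_def power_mult_distrib power2_eq_square power3_eq_cube power_add mult_2_right mult_2 mult_ac)
  have u_Suc: "u (Suc n) = - (x\<^sup>2 * q ^ n * t n)" for n
  proof -
    have "1 - x * q ^ Suc n \<noteq> 0" using ne[of "Suc n"] by simp
    then show ?thesis
      by (simp add: u_def t_def fine_term_def qpoch_Suc[of x q "Suc n"] Suc_choose_two power_add power2_eq_square)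
  qed
  \<comment> \<open>The index of \<open>t\<close> runs one ahead of that of \<open>s\<close>, so
    \<open>t 0\<close> has to be added back separately.\<close>
  have tele: "t (Suc n) + x ^ 3 * q * s n = u (Suc n) - u (Suc (Suc n))" for n
    unfolding s_t u_Suc[of "Suc n"] unfolding u_def by (simp add: algebra_simps power2_eq_square)
  have "u \<longlonglongrightarrow> 0 * (1 - x * 0)"
    unfolding u_def
    by (intro tendsto_mult tendsto_diff tendsto_const summable_LIMSEQ_zero[OF t]
        LIMSEQ_power_zero assms(1))
  then have "(\<lambda>n. u (Suc n)) \<longlonglongrightarrow> 0" by (simp add: LIMSEQ_Suc)
  then have "(\<lambda>n. u (Suc n) - u (Suc (Suc n))) sums (u (Suc 0) - 0)"
    by (rule telescope_sums')
  then have "(\<lambda>n. t (Suc n) + x ^ 3 * q * s n) sums u (Suc 0)" by (simp add: tele)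
  moreover have "(\<lambda>n. t (Suc n) + x ^ 3 * q * s n) sums (suminf t - t 0 + x ^ 3 * q * suminf s)"
    using t s by (intro sums_add sums_mult) (simp_all add: sums_Suc_iff summable_sums)
  ultimately have "suminf t - t 0 + x ^ 3 * q * suminf s = u (Suc 0)"
    by (metis sums_unique2)
  moreover have t0: "t 0 = 1 / (1 - x)"
    by (simp add: t_def fine_term_def qpoch_Suc binomial_eq_0)
  moreover have "u (Suc 0) = - (x\<^sup>2) / (1 - x)" using u_Suc[of 0] t0 by simp
  ultimately have "suminf t + x ^ 3 * q * suminf s = 1 / (1 - x) - x\<^sup>2 / (1 - x)"
    by (simp add: algebra_simps)
  also have "\<dots> = 1 + x" using x1 by (simp add: field_simps power2_eq_square)
  finally show ?thesis unfolding t_def s_def by (simp add: algebra_simps)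
qed

text \<open>Substituting F(x) = 1 + x E(x) into F(x) = 1 + x - x^3 q F(xq) gives exactly the
  recurrence required by \<open>partial_theta_sums\<close>.\<close>

lemma fine_partial_theta_sums:
  assumes "norm q < 1" "q \<noteq> 0" "x \<noteq> 0" and ne: "\<And>j. x * q ^ j \<noteq> 1"
  shows "(\<lambda>m. (-1) ^ m * x ^ (3 * m) * q ^ (2 * m + 3 * (m choose 2)) *
            (1 - x\<^sup>2 * q ^ (2 * m + 1))) sums ((suminf (fine_term x q) - 1) / x)"
proof -
  define y where "y m = x * q ^ m" for m
  define F where "F m = suminf (fine_term (y m) q)" for m
  define E where "E m = (F m - 1) / y m" for m
  have y0: "y m \<noteq> 0" for m using assms by (simp add: y_def)
  have ney: "y m * q ^ j \<noteq> 1" for m j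
    using ne[of "m + j"] by (simp add: y_def power_add mult.assoc)
  obtain B where B: "B > 0"
    "\<And>m n. norm (fine_term (x * q ^ m) q n) \<le> B * ((norm x ^ 2) ^ n * norm q ^ (n choose 2))"
    using norm_fine_term_le[OF assms(1) ne] by blast
  define C where "C = (\<Sum>n. B * ((norm x ^ 2) ^ n * norm q ^ (n choose 2)))"
  have F: "norm (F m) \<le> C" for m
    unfolding F_def C_def y_def using assms(1) B(2)
    by (intro norm_suminf_le summable_mult summable_power_choose_two) auto
  have rec: "E m = 1 - (x * q ^ m)\<^sup>2 * q - (x * q ^ m) ^ 3 * q\<^sup>2 * E (Suc m)" for m
  proof -
    have "F m = 1 + y m - y m ^ 3 * q * F (Suc m)"
      using suminf_fine_term_shift[OF assms(1) ney, of m] by (simp add: F_def y_def mult_ac)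
    moreover have "F (Suc m) = 1 + y m * q * E (Suc m)"
      using y0[of "Suc m"] by (simp add: E_def y_def field_simps)
    ultimately have "F m - 1 = y m * (1 - y m ^ 2 * q - y m ^ 3 * q\<^sup>2 * E (Suc m))"
      by (simp add: algebra_simps power2_eq_square power3_eq_cube)
    then show ?thesis using y0[of m] by (simp add: E_def) (simp add: y_def)
  qed
  \<comment> \<open>\<open>F\<close> is bounded along the orbit; the growth rate 1/|q| comes solely
    from dividing by \<open>y m\<close>.\<close>
  have "norm (E m) \<le> (C + 1) / norm x * (1 / norm q) ^ m" for m
  proof -
    have "norm (F m - 1) \<le> C + 1" using norm_triangle_ineq4[of "F m" 1] F[of m] by simp
    then have "norm (F m - 1) / norm (y m) \<le> (C + 1) / norm (y m)"
      by (intro divide_right_mono) auto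
    then show ?thesis by (simp add: E_def y_def norm_divide norm_mult norm_power power_one_over)
  qed
  from partial_theta_sums[OF assms(1) _ rec this] have
    "(\<lambda>m. (-1) ^ m * x ^ (3 * m) * q ^ (2 * m + 3 * (m choose 2)) *
            (1 - x\<^sup>2 * q ^ (2 * m + 1))) sums E 0" by simp
  then show ?thesis by (simp add: E_def F_def y_def)
qed

text \<open>The symbol of length n+1 contributes q to the power -(n choose 2) - n; its part q^(-n)
  cancels the numerator and leaves \<open>q ^ (n choose 2)\<close> upstairs.\<close>

lemma g33_inverse_base:
  assumes "w \<noteq> 0" "q \<noteq> 0"
  shows "g33 w (inverse q) = (\<Sum>n. - inverse w * fine_term (inverse w) q n)"
proof -
  have "inverse w ^ n * inverse q ^ n / qpoch w (inverse q) (n + 1) =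
      - inverse w * fine_term (inverse w) q n" for n
  proof -
    have "qpoch w (inverse q) (n + 1) =
        (- w) ^ n * - w * (inverse q ^ (n choose 2) * inverse q ^ n) * qpoch (inverse w) q (Suc n)"
      using qpoch_inverse_base[OF assms, of "n + 1"] by (simp add: Suc_choose_two power_add)
    moreover have "inverse ((- w) ^ n) = (-1) ^ n * inverse w ^ n"
      by (metis minus_one_power_iff power_inverse power_minus inverse_minus_eq)
    ultimately show ?thesis using assms
      by (simp add: fine_term_def divide_inverse power_inverse mult_2 power_add)
  qed
  then show ?thesis by (simp add: g33_def)
qed

section \<open>The rank series in the inverse base\<close>

lemma psi2_exponent: "n * (n + 1) div 2 = (n choose 2) + n"
proof -
  have "n * (n + 1) div 2 = Suc n choose 2" by (simp add: choose_two mult.commute)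
  then show ?thesis by (simp add: Suc_choose_two)
qed

lemma psi2_summand_le:
  fixes y q :: complex
  assumes "norm q < 1" "norm y \<le> c"
  shows "norm (y ^ n * q ^ (n * (n + 1) div 2)) \<le> c ^ n * norm q ^ (n choose 2)"
proof -
  have "norm q ^ (n * (n + 1) div 2) \<le> norm q ^ (n choose 2)"
    using assms(1) unfolding psi2_exponent by (intro power_decreasing) auto
  moreover have "norm y ^ n \<le> c ^ n" using assms(2) by (intro power_mono) auto
  moreover have "0 \<le> c" using assms(2) norm_ge_zero order_trans by blast
  ultimately show ?thesis
    unfolding norm_mult norm_power by (intro mult_mono) auto
qed

lemma summable_psi2:
  fixes y q :: complex
  assumes "norm q < 1"
  shows "summable (\<lambda>n. y ^ n * q ^ (n * (n + 1) div 2))"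
proof (rule summable_comparison_test')
  show "summable (\<lambda>n. norm y ^ n * norm q ^ (n choose 2))"
    using assms by (intro summable_power_choose_two) auto
  show "norm (y ^ n * q ^ (n * (n + 1) div 2)) \<le> norm y ^ n * norm q ^ (n choose 2)" for n
    using assms by (intro psi2_summand_le) auto
qed

text \<open>Splitting off two terms and shifting the index by 2 multiplies the argument by q^2,
  which is the effect of replacing x by xq in y = -x^2.\<close>

lemma psi2_shift:
  assumes "norm q < 1"
  shows "psi2 y q = 1 + y * q + y\<^sup>2 * q ^ 3 * psi2 (y * q\<^sup>2) q"
proof -
  define f where "f n = y ^ n * q ^ (n * (n + 1) div 2)" for n
  have "summable f" unfolding f_def by (intro summable_psi2 assms)
  then have "suminf f = (\<Sum>n. f (n + 2)) + (\<Sum>n<2. f n)"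
    by (rule suminf_split_initial_segment)
  moreover have "f (n + 2) = y\<^sup>2 * q ^ 3 * ((y * q\<^sup>2) ^ n * q ^ (n * (n + 1) div 2))" for n
    by (simp only: f_def psi2_exponent add_2_eq_Suc' Suc_choose_two)
      (simp add: power_add power_mult_distrib power2_eq_square power3_eq_cube mult_ac)
  moreover have "(\<Sum>n<2. f n) = 1 + y * q" by (simp add: f_def numeral_2_eq_2)
  moreover have "psi2 y q = suminf f" unfolding psi2_def f_def ..
  ultimately have "psi2 y q = (\<Sum>n. y\<^sup>2 * q ^ 3 * ((y * q\<^sup>2) ^ n * q ^ (n * (n + 1) div 2))) + (1 + y * q)"
    by (simp only:)
  also have "(\<Sum>n. y\<^sup>2 * q ^ 3 * ((y * q\<^sup>2) ^ n * q ^ (n * (n + 1) div 2))) = y\<^sup>2 * q ^ 3 * psi2 (y * q\<^sup>2) q"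
    unfolding psi2_def by (intro suminf_mult summable_psi2 assms)
  finally show ?thesis by simp
qed

section \<open>The rank series and its theta correction\<close>

definition rank_factor :: "complex \<Rightarrow> complex \<Rightarrow> nat \<Rightarrow> complex" where
  "rank_factor x q n = inverse (qpoch (x * q) q n * qpoch (q / x) q n)"

definition rank_sum :: "complex \<Rightarrow> complex \<Rightarrow> complex" where
  "rank_sum x q = (\<Sum>n. q ^ n * rank_factor x q n)"

text \<open>The correction T(x), normalized so that \<open>S2 x q\<close> equals -x^2 T(x) / (1 -
  x).\<close>

definition theta_quotient :: "complex \<Rightarrow> complex \<Rightarrow> complex" where
  "theta_quotient x q = x * psi2 (- (x\<^sup>2)) q * inverse (qpoch_inf (x * q) q * qpoch_inf (q / x) q)"

context
  fixes q :: complex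
  assumes q: "norm q < 1" "q \<noteq> 0"
begin

text \<open>The set of integer powers of \<open>q\<close> is stable under multiplication by
  \<open>q\<close>, so the whole orbit x q^m avoids it.\<close>

lemma not_power_intD:
  assumes "\<forall>l::int. x \<noteq> q powi l"
  shows "x * q ^ j \<noteq> 1" "x \<noteq> q ^ j" "x * q ^ m \<noteq> q powi k"
proof -
  have *: "x * q ^ m \<noteq> q powi k" for m k
  proof
    assume "x * q ^ m = q powi k"
    then have "x = q powi k / q powi int m" using q(2) by (simp add: field_simps)
    then have "x = q powi (k - int m)" using q(2) by (simp add: power_int_diff)
    with assms show False by blast
  qed
  show "x * q ^ j \<noteq> 1" "x \<noteq> q ^ j" "x * q ^ m \<noteq> q powi k"
    using *[of j 0] *[of 0 "int j"] *[of m k] by simp_all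
qed

lemma rank_denominators_nonzero:
  assumes "x \<noteq> 0" "\<forall>l::int. x \<noteq> q powi l"
  shows "x * q * q ^ j \<noteq> 1" "q / x * q ^ j \<noteq> 1" "inverse x * q ^ j \<noteq> 1"
  using not_power_intD(1)[OF assms(2), of "Suc j"] not_power_intD(2)[OF assms(2), of "Suc j"]
    not_power_intD(2)[OF assms(2), of j] assms(1)
  by (simp_all add: mult.assoc inverse_eq_divide)

lemma rank_factor_tendsto:
  assumes "x \<noteq> 0" "\<forall>l::int. x \<noteq> q powi l"
  shows "rank_factor x q \<longlonglongrightarrow> inverse (qpoch_inf (x * q) q * qpoch_inf (q / x) q)"
  unfolding rank_factor_def using rank_denominators_nonzero[OF assms]
  by (intro tendsto_inverse tendsto_mult qpoch_tendsto q) (simp_all add: qpoch_inf_nonzero q)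

text \<open>Along the orbit the argument xq moves towards 0, where the reciprocals stay bounded,
  while q/x moves outwards and costs a factor \<open>K\<close> per step.\<close>

lemma norm_rank_factor_le:
  assumes x: "x \<noteq> 0" "\<forall>l::int. x \<noteq> q powi l"
  obtains B K where "B > 0" "K > 0" "\<And>m n. norm (rank_factor (x * q ^ m) q n) \<le> B * K ^ m"
proof -
  obtain B where B: "B > 0" "\<And>m n. norm (inverse (qpoch (x * q * q ^ m) q n)) \<le> B"
    using inverse_qpoch_shift_bounded[OF q(1) rank_denominators_nonzero(1)[OF x]] by blast
  have "q / x \<noteq> 0" "\<And>j. q / x \<noteq> q ^ j"
  proof -
    show "q / x \<noteq> 0" using x q by simp
    fix j show "q / x \<noteq> q ^ j"
    proof
      assume "q / x = q ^ j"
      then have "x * q ^ j = q powi 1" using x(1) by (simp add: field_simps)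
      with not_power_intD(3)[OF x(2)] show False by blast
    qed
  qed
  then obtain D K where D: "D > 0" "K > 0"
      "\<And>m n. norm (inverse (qpoch (q / x / q ^ m) q n)) \<le> D * K ^ m"
    using inverse_qpoch_unshift_bound[OF q _ rank_denominators_nonzero(2)[OF x]] by metis
  have "norm (rank_factor (x * q ^ m) q n) \<le> (B * D) * K ^ m" for m n
  proof -
    have "norm (rank_factor (x * q ^ m) q n) =
        norm (inverse (qpoch (x * q * q ^ m) q n)) * norm (inverse (qpoch (q / x / q ^ m) q n))"
      by (simp add: rank_factor_def norm_mult norm_inverse mult_ac)
    also have "\<dots> \<le> B * (D * K ^ m)"
      using B(1) by (intro mult_mono B D) auto
    finally show ?thesis by (simp add: mult_ac)
  qed
  moreover have "B * D > 0" using B D by simp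
  ultimately show ?thesis using D(2) that by blast
qed

lemma summable_rank_sum:
  assumes "x \<noteq> 0" "\<forall>l::int. x \<noteq> q powi l"
  shows "summable (\<lambda>n. q ^ n * rank_factor x q n)"
proof -
  obtain B K where "B > 0" "K > 0" and B: "\<And>m n. norm (rank_factor (x * q ^ m) q n) \<le> B * K ^ m"
    using norm_rank_factor_le[OF assms] by blast
  show ?thesis
  proof (rule summable_comparison_test')
    show "summable (\<lambda>n. norm q ^ n * B)"
      using q(1) by (intro summable_mult2 summable_geometric) simp
    show "norm (q ^ n * rank_factor x q n) \<le> norm q ^ n * B" for n
      using B[of 0 n] by (simp add: norm_mult norm_power mult_left_mono)
  qed
qed

text \<open>The combined summands telescope. The infinite product on the right is the boundary term
  at infinity; the boundary term at n = 0 supplies the rest.\<close>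

lemma rank_sum_shift:
  assumes x: "x \<noteq> 0" "\<forall>l::int. x \<noteq> q powi l"
  shows "rank_sum x q + x ^ 3 * q\<^sup>2 * (1 - x) / (1 - x * q) * rank_sum (x * q) q =
    (1 - x\<^sup>2 * q) * (1 - x + x * inverse (qpoch_inf (x * q) q * qpoch_inf (q / x) q))"
proof -
  define k where "k = x ^ 3 * q\<^sup>2 * (1 - x) / (1 - x * q)"
  define v where "v = rank_factor x q"
  define J where "J = inverse (qpoch_inf (x * q) q * qpoch_inf (q / x) q)"
  \<comment> \<open>The telescoper is \<open>v n * r (q ^ n)\<close>; the factor \<open>1 - Q / x\<close> cancels the new pole of
    \<open>v (Suc n)\<close>, and the linear factor then comes from comparing powers of \<open>Q\<close>.\<close>
  define r where "r Q = (1 - Q / x) * (x - x ^ 3 * q - x\<^sup>2 * q * Q) / (1 - x * q * Q)" for Q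
  have v: "v \<longlonglongrightarrow> J" unfolding v_def J_def using x by (rule rank_factor_tendsto)
  have xq: "x * q \<noteq> 0" "\<forall>l::int. x * q \<noteq> q powi l"
    using x(1) q(2) not_power_intD(3)[OF x(2), of 1] by simp_all
  note nz = rank_denominators_nonzero[OF x]
  have n1: "1 - x * q ^ n \<noteq> 0" for n using not_power_intD(1)[OF x(2), of n] by simp
  have n2: "1 - q ^ n / x \<noteq> 0" for n using not_power_intD(2)[OF x(2), of n] x(1) by simp
  have v_Suc: "v (Suc n) = v n / ((1 - x * q * q ^ n) * (1 - q * q ^ n / x))" for n
    by (simp add: v_def rank_factor_def qpoch_Suc divide_inverse mult_ac)
  \<comment> \<open>The factor (1 - x)/(1 - xq) in \<open>k\<close> compensates the changes at the
    front of both symbols, so the shifted summand becomes a rational multiple of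
    \<open>v n\<close>.\<close>
  have shift: "k * (q ^ Suc n * rank_factor (x * q) q (Suc n)) =
      - (x ^ 4 * q ^ 3 * q ^ n * v n) / ((1 - x * q * q ^ n) * (1 - x * q\<^sup>2 * q ^ n))" for n
  proof -
    have "qpoch (x * q) q (Suc (Suc n)) = (1 - x * q) * qpoch (x * q * q) q (Suc n)"
      by (rule qpoch_Suc_shift)
    moreover have "qpoch (x * q) q (Suc (Suc n)) =
        qpoch (x * q) q n * ((1 - x * q * q ^ n) * (1 - x * q\<^sup>2 * q ^ n))"
      by (simp add: qpoch_Suc power2_eq_square mult_ac)
    ultimately have 1: "inverse (1 - x * q) * inverse (qpoch (x * q * q) q (Suc n)) =
        inverse (qpoch (x * q) q n) * inverse ((1 - x * q * q ^ n) * (1 - x * q\<^sup>2 * q ^ n))"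
      by (metis inverse_mult_distrib)
    have "qpoch (q / (x * q)) q (Suc n) = (1 - 1 / x) * qpoch (q / x) q n"
      using q(2) by (simp add: qpoch_Suc_shift)
    moreover have "1 - x = - x * (1 - 1 / x)" using x(1) by (simp add: field_simps)
    moreover have "1 - 1 / x \<noteq> 0" using n2[of 0] by simp
    \<comment> \<open>Generic cancellation, applied with c = 1 - 1/x and d = 1 - x.\<close>
    moreover have "X = c * P \<Longrightarrow> d = - x * c \<Longrightarrow> c \<noteq> 0 \<Longrightarrow> d * inverse X = - x * inverse P"
      for X P c d :: complex by simp
    ultimately have 2: "(1 - x) * inverse (qpoch (q / (x * q)) q (Suc n)) = - x * inverse (qpoch (q / x) q n)"
      by blast
    have "k * (q ^ Suc n * rank_factor (x * q) q (Suc n)) =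
        x ^ 3 * q\<^sup>2 * q ^ Suc n * ((1 - x) * inverse (qpoch (q / (x * q)) q (Suc n))) *
        (inverse (1 - x * q) * inverse (qpoch (x * q * q) q (Suc n)))"
      by (simp add: k_def rank_factor_def divide_inverse mult_ac)
    also have "\<dots> = - (x ^ 4 * q ^ 3 * q ^ n * v n) / ((1 - x * q * q ^ n) * (1 - x * q\<^sup>2 * q ^ n))"
      unfolding 1 2
      by (simp add: v_def rank_factor_def divide_inverse power2_eq_square eval_nat_numeral mult_ac)
    finally show ?thesis .
  qed
  have tele: "q ^ n * v n + k * (q ^ Suc n * rank_factor (x * q) q (Suc n))
      = v (Suc n) * r (q ^ Suc n) - v n * r (q ^ n)" for n
  proof -
    define Q where "Q = q ^ n"
    define A where "A = 1 - x * q * Q"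
    define B where "B = 1 - x * q\<^sup>2 * Q"
    have A: "A \<noteq> 0" and B: "B \<noteq> 0" and C: "1 - q * Q / x \<noteq> 0"
      using n1[of "Suc n"] n1[of "Suc (Suc n)"] n2[of "Suc n"]
      by (simp_all add: A_def B_def Q_def power2_eq_square mult_ac)
    have rS: "r (q ^ Suc n) = (1 - q * Q / x) * (x - x ^ 3 * q - x\<^sup>2 * q * (q * Q)) / B"
      by (simp add: r_def B_def Q_def power2_eq_square mult_ac)
    have "v (Suc n) * r (q ^ Suc n) = v n * (x - x ^ 3 * q - x\<^sup>2 * q * (q * Q)) / (A * B)"
      unfolding v_Suc rS using C by (simp add: A_def Q_def divide_inverse mult_ac)
    moreover have "r (q ^ n) = (1 - Q / x) * (x - x ^ 3 * q - x\<^sup>2 * q * Q) / A"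
      by (simp add: r_def A_def Q_def)
    moreover have "v n * c / (A * B) - v n * (d / A) = v n * (c - d * B) / (A * B)" for c d
      using A B by (simp add: field_simps)
    ultimately have "v (Suc n) * r (q ^ Suc n) - v n * r (q ^ n) =
        v n * ((x - x ^ 3 * q - x\<^sup>2 * q * (q * Q)) - (1 - Q / x) * (x - x ^ 3 * q - x\<^sup>2 * q * Q) * B) / (A * B)"
      by (simp only:)
    also have "(x - x ^ 3 * q - x\<^sup>2 * q * (q * Q)) - (1 - Q / x) * (x - x ^ 3 * q - x\<^sup>2 * q * Q) * B
        = Q * A * B - x ^ 4 * q ^ 3 * Q"
      using x(1) by (simp add: A_def B_def field_simps power2_eq_square eval_nat_numeral)
    also have "v n * (Q * A * B - x ^ 4 * q ^ 3 * Q) / (A * B) =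
        Q * v n + - (x ^ 4 * q ^ 3 * Q * v n) / (A * B)"
      using A B by (simp add: field_simps)
    finally show ?thesis unfolding shift by (simp add: A_def B_def Q_def)
  qed
  have "(\<lambda>n. v n * r (q ^ n)) \<longlonglongrightarrow> J * r 0"
    unfolding r_def
    by (intro tendsto_mult tendsto_divide tendsto_diff tendsto_const v LIMSEQ_power_zero q(1)) (simp_all add: x(1))
  then have "(\<lambda>n. q ^ n * v n + k *
      (q ^ Suc n * rank_factor (x * q) q (Suc n))) sums (J * r 0 - v 0 * r (q ^ 0))"
    unfolding tele by (rule telescope_sums)
  moreover have "(\<lambda>n. q ^ n * v n + k *
      (q ^ Suc n * rank_factor (x * q) q (Suc n))) sums
      (rank_sum x q + k * (rank_sum (x * q) q - 1))"
  proof (intro sums_add sums_mult)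
    show "(\<lambda>n. q ^ n * v n) sums rank_sum x q"
      unfolding rank_sum_def v_def by (intro summable_sums summable_rank_sum x)
    have "(\<lambda>n. q ^ n * rank_factor (x * q) q n) sums rank_sum (x * q) q"
      unfolding rank_sum_def by (intro summable_sums summable_rank_sum xq)
    \<comment> \<open>The shifted series starts at index 1, so its zeroth term 1 is
      subtracted.\<close>
    then show "(\<lambda>n. q ^ Suc n * rank_factor (x * q) q (Suc n)) sums (rank_sum (x * q) q - 1)"
      by (subst sums_Suc_iff) (simp add: rank_factor_def)
  qed
  ultimately have "rank_sum x q + k * (rank_sum (x * q) q - 1) =
      J * r 0 - v 0 * r 1"
    by (simp add: sums_iff)
  then have eq: "rank_sum x q + k * rank_sum (x * q) q =
      J * r 0 - r 1 + k"
    by (simp add: v_def rank_factor_def algebra_simps)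
  have "(1 - 1 / x) * (x - x ^ 3 * q - x\<^sup>2 * q * 1) = (x - 1) * (1 - x\<^sup>2 * q - x * q)"
    using x(1) by (simp add: field_simps power2_eq_square power3_eq_cube)
  then have r1: "r 1 = (x - 1) * (1 - x\<^sup>2 * q - x * q) / (1 - x * q)"
    by (simp add: r_def)
  have "k = x ^ 3 * q\<^sup>2 * (1 - x) / (1 - x * q)" by (rule k_def)
  \<comment> \<open>The polynomial 1 - xq - x^2 q + x^3 q^2 factors as (1 - xq)(1 - x^2 q), and the
    first factor cancels the denominator.\<close>
  then have "k - r 1 = (1 - x) * (1 - x\<^sup>2 * q) * (1 - x * q) / (1 - x * q)"
    unfolding r1 by (simp only: diff_divide_distrib[symmetric])
      (simp add: algebra_simps power2_eq_square power3_eq_cube)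
  also have "\<dots> = (1 - x) * (1 - x\<^sup>2 * q)"
    using n1[of 1] by simp
  finally have "J * r 0 - r 1 + k = J * r 0 + (1 - x) * (1 - x\<^sup>2 * q)" by (simp add: algebra_simps)
  also have "\<dots> = (1 - x\<^sup>2 * q) * (1 - x + x * J)"
    by (simp add: r_def algebra_simps power2_eq_square power3_eq_cube)
  finally show ?thesis using eq unfolding J_def k_def by simp
qed

text \<open>After \<open>psi2_shift\<close>, the tail of psi2 cancels against the T(xq) term,
  because the infinite products at x and xq differ only by the factors 1 - xq and 1 - 1/x.\<close>

lemma theta_quotient_shift:
  assumes x: "x \<noteq> 0" "\<forall>l::int. x \<noteq> q powi l"
  shows "theta_quotient x q + x ^ 3 * q\<^sup>2 * (1 - x) / (1 - x * q) * theta_quotient (x * q) q =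
    (1 - x\<^sup>2 * q) * (x * inverse (qpoch_inf (x * q) q * qpoch_inf (q / x) q))"
proof -
  note nz = rank_denominators_nonzero[OF x]
  define P where "P = qpoch_inf (x * q * q) q"
  define R where "R = qpoch_inf (q / x) q"
  define T where "T = psi2 (- (x\<^sup>2) * q\<^sup>2) q"
  have 1: "qpoch_inf (x * q) q = (1 - x * q) * P"
    unfolding P_def by (intro qpoch_inf_shift q nz)
  have "qpoch_inf (inverse x) q = (1 - inverse x) * qpoch_inf (inverse x * q) q"
    by (intro qpoch_inf_shift q nz)
  moreover have "q / (x * q) = inverse x" "inverse x * q = q / x"
    using q(2) by (simp_all add: divide_inverse)
  ultimately have 2: "qpoch_inf (q / (x * q)) q = (1 - inverse x) * R"
    by (simp only: R_def)
  have T: "psi2 (- (x\<^sup>2)) q = 1 - x\<^sup>2 * q + x ^ 4 * q ^ 3 * T"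
    using psi2_shift[OF q(1), of "- (x\<^sup>2)"] by (simp add: T_def flip: power_mult)
  have left: "theta_quotient x q =
      x * (1 - x\<^sup>2 * q) * (inverse (1 - x * q) * inverse P * inverse R) +
      x ^ 5 * q ^ 3 * T * (inverse (1 - x * q) * inverse P * inverse R)"
    unfolding theta_quotient_def 1 R_def[symmetric] T inverse_mult_distrib
    by (simp add: distrib_left distrib_right eval_nat_numeral mult_ac)
  have "1 - inverse x \<noteq> 0" "1 - x = - x * (1 - inverse x)"
    using nz(3)[of 0] x(1) by (simp_all add: field_simps)
  then have fac: "(1 - x) * inverse (1 - inverse x) = - x" by simp
  have "x ^ 3 * q\<^sup>2 * (1 - x) / (1 - x * q) * theta_quotient (x * q) q =
      x ^ 4 * q ^ 3 * T * ((1 - x) * inverse (1 - inverse x)) * (inverse (1 - x * q) * inverse P * inverse R)"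
    unfolding theta_quotient_def 2 P_def[symmetric]
    by (simp add: T_def divide_inverse power_mult_distrib eval_nat_numeral mult_ac)
  also have "\<dots> = - (x ^ 5 * q ^ 3 * T * (inverse (1 - x * q) * inverse P * inverse R))"
    unfolding fac by (simp add: eval_nat_numeral mult_ac)
  finally show ?thesis unfolding left 1 R_def[symmetric] by (simp add: mult_ac)
qed

text \<open>The infinite product inherits the bound \<open>B * K ^ m\<close> as a limit in n of
  \<open>rank_factor\<close>, and psi2 is bounded uniformly since |x q^m| is at most |x|.\<close>

lemma norm_theta_quotient_le:
  assumes x: "x \<noteq> 0" "\<forall>l::int. x \<noteq> q powi l"
    and B: "\<And>m n. norm (rank_factor (x * q ^ m) q n) \<le> B * K ^ m"
  obtains C where "C \<ge> 0" "\<And>m. norm (theta_quotient (x * q ^ m) q) \<le> C * (B * K ^ m)"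
proof -
  define S where "S = (\<Sum>n. (norm x ^ 2) ^ n * norm q ^ (n choose 2))"
  define C where "C = norm x * S"
  have S: "S \<ge> 0"
    unfolding S_def using q(1) by (intro suminf_nonneg summable_power_choose_two) auto
  have "norm (theta_quotient (x * q ^ m) q) \<le> C * (B * K ^ m)" for m
  proof -
    let ?y = "x * q ^ m"
    have y: "?y \<noteq> 0" "\<forall>l::int. ?y \<noteq> q powi l"
      using x(1) q(2) not_power_intD(3)[OF x(2)] by simp_all
    have y_le: "norm ?y \<le> norm x"
      using q(1) by (simp add: norm_mult norm_power power_le_one mult_left_le)
    have "norm (inverse (qpoch_inf (?y * q) q * qpoch_inf (q / ?y) q)) \<le> B * K ^ m"
      using tendsto_norm[OF rank_factor_tendsto[OF y]] B
      by (intro LIMSEQ_le_const2) auto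
    moreover have "norm (- (?y\<^sup>2)) \<le> norm x ^ 2"
      using y_le by (simp only: norm_minus_cancel norm_power) (intro power_mono, auto)
    then have "norm (psi2 (- (?y\<^sup>2)) q) \<le> S"
      unfolding psi2_def S_def using q(1)
      by (intro norm_suminf_le psi2_summand_le summable_power_choose_two) auto
    ultimately show ?thesis
      unfolding theta_quotient_def C_def norm_mult[of _ "inverse _"] norm_mult[of ?y "psi2 _ _"]
      using y_le S by (intro mult_mono) auto
  qed
  moreover have "C \<ge> 0" using S by (simp add: C_def)
  ultimately show ?thesis by (intro that[of C]) auto
qed

text \<open>Subtracting the two shift equations cancels the infinite product. Dividing by 1 - x then
  turns the coefficient of the shifted difference into x^3 q^2, as \<open>partial_theta_sums\<close>
  requires.\<close>

lemma rank_partial_theta_sums: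
  assumes x: "x \<noteq> 0" "\<forall>l::int. x \<noteq> q powi l"
  shows "(\<lambda>m. (-1) ^ m * x ^ (3 * m) * q ^ (2 * m + 3 * (m choose 2)) *
            (1 - x\<^sup>2 * q ^ (2 * m + 1))) sums ((rank_sum x q - theta_quotient x q) / (1 - x))"
proof -
  define y where "y m = x * q ^ m" for m
  define D where "D m = rank_sum (y m) q - theta_quotient (y m) q" for m
  define E where "E m = D m / (1 - y m)" for m
  have y: "y m \<noteq> 0" "\<forall>l::int. y m \<noteq> q powi l" for m
    using x(1) q(2) not_power_intD(3)[OF x(2)] by (simp_all add: y_def)
  have y1: "1 - y m \<noteq> 0" for m using not_power_intD(1)[OF y(2), of m 0] by simp
  have y_Suc: "y (Suc m) = y m * q" for m by (simp add: y_def)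
  obtain B K where B0: "B > 0" and K: "K > 0" and B: "\<And>m n. norm (rank_factor (x * q ^ m) q n) \<le> B * K ^ m"
    using norm_rank_factor_le[OF x] by blast
  obtain C where C: "C \<ge> 0" "\<And>m. norm (theta_quotient (x * q ^ m) q) \<le> C * (B * K ^ m)"
    using norm_theta_quotient_le[OF x B] by metis
  obtain L where L: "L > 0" "\<And>m n. norm (inverse (qpoch (x * q ^ m) q n)) \<le> L"
    using inverse_qpoch_shift_bounded[OF q(1) not_power_intD(1)[OF x(2)]] by blast
  have rec: "E m = 1 - (x * q ^ m)\<^sup>2 * q - (x * q ^ m) ^ 3 * q\<^sup>2 * E (Suc m)" for m
  proof -
    define k where "k = y m ^ 3 * q\<^sup>2 * (1 - y m) / (1 - y m * q)"
    have "D m + k * D (Suc m) = (rank_sum (y m) q + k * rank_sum (y m * q) q) -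
        (theta_quotient (y m) q + k * theta_quotient (y m * q) q)"
      by (simp add: D_def y_Suc algebra_simps)
    also have "\<dots> = (1 - (y m)\<^sup>2 * q) * (1 - y m)"
      unfolding k_def rank_sum_shift[OF y] theta_quotient_shift[OF y] right_diff_distrib[symmetric]
      by simp
    finally have "D m + k * D (Suc m) = (1 - (y m)\<^sup>2 * q) * (1 - y m)" .
    moreover have "k * D (Suc m) = (y m ^ 3 * q\<^sup>2 * E (Suc m)) * (1 - y m)"
      by (simp add: E_def y_Suc k_def)
    ultimately have "D m = (1 - (y m)\<^sup>2 * q - y m ^ 3 * q\<^sup>2 * E (Suc m)) * (1 - y m)"
      by (simp only: left_diff_distrib eq_diff_eq)
    then show ?thesis using y1[of m] by (simp add: E_def) (simp add: y_def)
  qed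
  have G: "norm (rank_sum (y m) q) \<le> 1 / (1 - norm q) * (B * K ^ m)" for m
  proof -
    have "norm (rank_sum (y m) q) \<le> (\<Sum>n. norm q ^ n * (B * K ^ m))"
      unfolding rank_sum_def y_def using q(1)
      by (intro norm_suminf_le summable_mult2 summable_geometric)
        (auto simp: norm_mult norm_power intro!: mult_left_mono B)
    also have "\<dots> = 1 / (1 - norm q) * (B * K ^ m)"
      using q(1) by (subst suminf_mult2[symmetric]) (auto simp: suminf_geometric summable_geometric)
    finally show ?thesis .
  qed
  have "norm (E m) \<le> (1 / (1 - norm q) + C) * B * L * K ^ m" for m
  proof -
    have "norm (D m) \<le> (1 / (1 - norm q) + C) * (B * K ^ m)"
      using norm_triangle_ineq4[of "rank_sum (y m) q" "theta_quotient (y m) q"] G[of m] C(2)[of m]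
      by (simp add: D_def y_def algebra_simps)
    \<comment> \<open>A symbol of length 1 is the single factor \<open>1 - y m\<close>, so
      \<open>L\<close> bounds its reciprocal.\<close>
    moreover have "norm (inverse (1 - y m)) \<le> L"
      using L(2)[of m 1] by (simp add: qpoch_Suc y_def)
    ultimately have "norm (D m) * norm (inverse (1 - y m)) \<le> (1 / (1 - norm q) + C) * (B * K ^ m) * L"
      using q(1) C(1) B0 K L(1) by (intro mult_mono) auto
    then show ?thesis by (simp add: E_def divide_inverse norm_mult mult_ac)
  qed
  from partial_theta_sums[OF q(1) _ rec this] K have
    "(\<lambda>m. (-1) ^ m * x ^ (3 * m) * q ^ (2 * m + 3 * (m choose 2)) *
            (1 - x\<^sup>2 * q ^ (2 * m + 1))) sums E 0" by simp
  then show ?thesis by (simp add: E_def D_def y_def)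
qed

end

text \<open>The two inverted symbols together contribute q^(-n^2 - n) and the factors involving
  \<open>w\<close> cancel, so \<open>q ^ n\<close> survives against the numerator. The explicit 1 in
  \<open>R_fun\<close> is the term n = 0.\<close>

lemma R_fun_inverse_base:
  assumes q: "norm q < 1" "q \<noteq> 0" and w: "w \<noteq> 0" "\<forall>l::int. inverse w \<noteq> q powi l"
  shows "R_fun w (inverse q) = rank_sum (inverse w) q"
proof -
  have "2 * (n choose 2) + n = n\<^sup>2" for n :: nat
    by (induction n) (simp_all add: Suc_choose_two power2_eq_square)
  then have sq: "p ^ (n\<^sup>2) = p ^ (n choose 2) * p ^ (n choose 2) * p ^ n" for p :: complex and n
    by (metis mult_2 power_add)
  have "inverse q ^ (n\<^sup>2) / (qpoch (w * inverse q) (inverse q) n * qpoch (inverse w * inverse q) (inverse q) n)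
      = q ^ n * rank_factor (inverse w) q n" for n
  proof -
    have "(- (w * inverse q)) ^ n * (- (inverse w * inverse q)) ^ n = inverse q ^ n * inverse q ^ n"
    proof -
      have "- (w * inverse q) * - (inverse w * inverse q) = inverse q * inverse q"
        using w(1) by simp
      then show ?thesis by (simp only: power_mult_distrib[symmetric])
    qed
    then have "qpoch (w * inverse q) (inverse q) n * qpoch (inverse w * inverse q) (inverse q) n =
        inverse q ^ (n\<^sup>2) * inverse q ^ n * (qpoch (inverse w * q) q n * qpoch (w * q) q n)"
      using qpoch_inverse_base[of "w * inverse q" q n] qpoch_inverse_base[of "inverse w * inverse q" q n] q w
      by (simp add: sq mult_ac)
    then show ?thesis using q
      by (simp add: rank_factor_def divide_inverse power_inverse mult_ac)
  qed
  moreover have "summable (\<lambda>n. q ^ n * rank_factor (inverse w) q n)"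
    using q w by (intro summable_rank_sum) simp_all
  ultimately show ?thesis
    using suminf_split_head[of "\<lambda>n. q ^ n * rank_factor (inverse w) q n"]
    by (simp add: R_fun_def rank_sum_def rank_factor_def Let_def)
qed

section \<open>Both identities, read at x = 1/w\<close>

theorem theorem3p2:
  fixes q :: complex
  assumes "0 < norm q" and "norm q < 1"
  shows "(\<forall>w :: complex. w \<noteq> 0 \<and> (\<forall>l :: int. w \<noteq> q powi l) \<longrightarrow>
            g32 w (inverse q) = psi1 (inverse w) q + S2 (inverse w) q) \<and>
         (\<forall>w :: complex. w \<noteq> 0 \<and> (\<forall>l :: nat. w \<noteq> q ^ l) \<longrightarrow>
            g33 w (inverse q) = psi1 (inverse w) q)"
proof (intro conjI allI impI; elim conjE)
  fix w :: complex
  assume w: "w \<noteq> 0" and ne: "\<forall>l :: int. w \<noteq> q powi l"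
  have q: "norm q < 1" "q \<noteq> 0" using assms by auto
  define x where "x = inverse w"
  have x: "x \<noteq> 0" "\<forall>l :: int. x \<noteq> q powi l"
  proof -
    show "x \<noteq> 0" using w by (simp add: x_def)
    show "\<forall>l :: int. x \<noteq> q powi l"
    proof
      fix l :: int
      show "x \<noteq> q powi l" using ne[rule_format, of "- l"] w q
        by (metis x_def inverse_inverse_eq power_int_minus)
    qed
  qed
  have w_eq: "w = inverse x" by (simp add: x_def)
  have x1: "1 - x \<noteq> 0" "1 - inverse x \<noteq> 0" "1 - x = - x * (1 - inverse x)"
    using not_power_intD(1)[OF q x(2), of 0] x(1) by (auto simp: field_simps)
  note nz = rank_denominators_nonzero[OF q x]
  \<comment> \<open>The partial theta series is split: the \<open>rank_sum\<close> part produces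
    g32, and the \<open>theta_quotient\<close> part is cancelled by S2.\<close>
  have "psi1 x q = - x - x\<^sup>2 * (rank_sum x q / (1 - x) - theta_quotient x q / (1 - x))"
    unfolding diff_divide_distrib[symmetric] by (intro psi1_eq_partial_theta rank_partial_theta_sums q x)
  moreover have "S2 x q = - (x\<^sup>2 * (theta_quotient x q / (1 - x)))"
  proof -
    have "qpoch_inf (inverse x) q = (1 - inverse x) * qpoch_inf (q / x) q"
      using qpoch_inf_shift[OF q(1) nz(3)] by (simp add: divide_inverse mult_ac)
    then have "S2 x q = x\<^sup>2 * psi2 (- (x\<^sup>2)) q * inverse (1 - inverse x) *
        inverse (qpoch_inf (x * q) q * qpoch_inf (q / x) q)"
      by (simp add: S2_def divide_inverse mult_ac)
    also have "inverse (1 - inverse x) = - x / (1 - x)" using x1 by (simp add: field_simps)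
    finally show ?thesis by (simp add: theta_quotient_def)
  qed
  moreover have "g32 w (inverse q) = - x - x\<^sup>2 * (rank_sum x q / (1 - x))"
  proof -
    have "R_fun w (inverse q) = rank_sum x q"
      using R_fun_inverse_base[OF q w] x(2) by (simp add: x_def)
    moreover have "1 / (w * (1 - w)) = - (x\<^sup>2 / (1 - x))"
      unfolding w_eq using x1 x(1) by (simp add: field_simps power2_eq_square)
    ultimately show ?thesis by (simp add: g32_def) (simp add: w_eq divide_inverse)
  qed
  ultimately show "g32 w (inverse q) = psi1 (inverse w) q + S2 (inverse w) q"
    unfolding x_def[symmetric] by (simp only: right_diff_distrib) simp
next
  fix w :: complex
  assume w: "w \<noteq> 0" and ne: "\<forall>l :: nat. w \<noteq> q ^ l"
  have q: "norm q < 1" "q \<noteq> 0" using assms by auto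
  define x where "x = inverse w"
  \<comment> \<open>Here w differing from q^j means exactly that the factor 1 - x q^j of the
    denominators in F does not vanish.\<close>
  have x: "x \<noteq> 0" "x * q ^ j \<noteq> 1" for j
    using ne[rule_format, of j] w by (simp_all add: x_def field_simps)
  have "psi1 x q = - x - x\<^sup>2 * ((suminf (fine_term x q) - 1) / x)"
    by (intro psi1_eq_partial_theta fine_partial_theta_sums q x)
  also have "\<dots> = - x * suminf (fine_term x q)"
    using x(1) by (simp add: field_simps power2_eq_square)
  also have "\<dots> = (\<Sum>n. - x * fine_term x q n)"
    by (intro suminf_mult[symmetric] summable_fine_term q x)
  also have "\<dots> = g33 w (inverse q)"
    using g33_inverse_base[OF w q(2)] by (simp add: x_def)
  finally show "g33 w (inverse q) = psi1 (inverse w) q" by (simp add: x_def)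
qed

end
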